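(* Let $G\subseteq\binom{[n]}{2}$ be a simple loopless graph on $[n]$, let $\mathsf{Ish}(G)=\{x_i-x_j=0: 1\le i<j\le n\}\cup\{x_1-x_j=i: ij\in G\}$ in $\mathbb{R}^n$, and let $w\in\mathfrak{S}(n)$ with cone $wC=\{x: x_{w(1)}>\cdots>x_{w(n)}\}$. Let $\Psi^+(G,w)$ be the set of hyperplanes $x_1-x_j=i$ with $ij\in G$ and $w^{-1}(1)<w^{-1}(j)$ (these are exactly the hyperplanes of $\mathsf{Ish}(G)$ not through the origin meeting $wC$), partially ordered by declaring $(x_1-x_j=i)\preceq(x_1-x_{j'}=i')$ if and only if $i\le i'$ and $w^{-1}(j')\le w^{-1}(j)$. Then the map sending a region $R$ of $\mathsf{Ish}(G)$ contained in $wC$ to the set of hyperplanes of $\mathsf{Ish}(G)$ lying above $R$ is a bijection from the set of regions of $\mathsf{Ish}(G)$ contained in $wC$ to the set of order filters (up-closed subsets) of $\Psi^+(G,w)$. Moreover, the minimal elements of the filter associated to $R$ are exactly the ceilings of $R$.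
   Context: Edges of $G$ are written $ij$ with $i<j$. Regions are connected components of the complement of the union of the hyperplanes. A hyperplane $H$ not containing the origin lies above a region $R$ if $R$ and the origin lie in the same open half-space of $H$. A ceiling of $R$ is a hyperplane of the arrangement, not containing the origin, which is the affine span of a codimension-one face of $\bar R$ and such that $R$ and the origin lie in the same half-space of it.
   Formalization: The map sends R to the hyperplanes of Ish(G) that meet wC and lie above R; without "meet wC" the claim fails, e.g. n=2, G={12}, w=21, where x_1-x_2=1 lies above the only region in wC but Ψ^+(G,w) is empty. *)

theory Defs
  imports "HOL-Analysis.Analysis"
begin

text \<open>
  The coordinates of \<open>real ^ 'n\<close> are numbered by \<open>[n] = {1..CARD('n)}\<close> through a bijection
  \<open>\<iota> :: nat \<Rightarrow> 'n\<close>, so that \<open>x\<^sub>i\<close> is \<open>x $ \<iota> i\<close>.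
\<close>

definition edge :: "nat set set \<Rightarrow> nat \<Rightarrow> nat \<Rightarrow> bool" where
  "edge G i j \<longleftrightarrow> i < j \<and> {i, j} \<in> G"

definition hyp :: "(nat \<Rightarrow> 'n::finite) \<Rightarrow> nat \<Rightarrow> nat \<Rightarrow> real \<Rightarrow> (real ^ 'n) set" where
  "hyp \<iota> a b c = {x. x $ \<iota> a - x $ \<iota> b = c}"

definition Ish :: "(nat \<Rightarrow> 'n::finite) \<Rightarrow> nat set set \<Rightarrow> (real ^ 'n) set set" where
  "Ish \<iota> G = {hyp \<iota> i j 0 | i j. 1 \<le> i \<and> i < j \<and> j \<le> CARD('n)}
           \<union> {hyp \<iota> 1 j (real i) | i j. edge G i j}"

definition cone_of_perm :: "(nat \<Rightarrow> 'n::finite) \<Rightarrow> (nat \<Rightarrow> nat) \<Rightarrow> (real ^ 'n) set" where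
  "cone_of_perm \<iota> w = {x. \<forall>k\<in>{1..<CARD('n)}. x $ \<iota> (w k) > x $ \<iota> (w (k + 1))}"

definition regions :: "'a::topological_space set set \<Rightarrow> 'a set set" where
  "regions \<A> = components (- \<Union>\<A>)"

text \<open>The opposite half-space \<open>{x. a \<bullet> x > b}\<close> is obtained from \<open>- a\<close> and \<open>- b\<close>.\<close>

definition open_halfspaces :: "'a::euclidean_space set \<Rightarrow> 'a set set" where
  "open_halfspaces H = {{x. a \<bullet> x < b} | a b. a \<noteq> 0 \<and> H = {x. a \<bullet> x = b}}"

definition lies_above :: "'a::euclidean_space set \<Rightarrow> 'a set \<Rightarrow> bool" where
  "lies_above H R \<longleftrightarrow> 0 \<notin> H \<and> (\<exists>S\<in>open_halfspaces H. R \<subseteq> S \<and> 0 \<in> S)"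

definition ceilings :: "'a::euclidean_space set set \<Rightarrow> 'a set \<Rightarrow> 'a set set" where
  "ceilings \<A> R =
    {H \<in> \<A>. lies_above H R \<and> (\<exists>F. F facet_of closure R \<and> affine hull F = H)}"

definition Psi :: "(nat \<Rightarrow> 'n::finite) \<Rightarrow> nat set set \<Rightarrow> (nat \<Rightarrow> nat) \<Rightarrow> (real ^ 'n) set set" where
  "Psi \<iota> G w = {hyp \<iota> 1 j (real i) | i j. edge G i j \<and> inv w 1 < inv w j}"

definition Psi_order ::
    "(nat \<Rightarrow> 'n::finite) \<Rightarrow> nat set set \<Rightarrow> (nat \<Rightarrow> nat) \<Rightarrow> (real ^ 'n) set rel" where
  "Psi_order \<iota> G w =
    {(hyp \<iota> 1 j (real i), hyp \<iota> 1 j' (real i')) | i j i' j'.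
       edge G i j \<and> inv w 1 < inv w j \<and> edge G i' j' \<and> inv w 1 < inv w j' \<and>
       i \<le> i' \<and> inv w j' \<le> inv w j}"

definition order_filters :: "'a set \<Rightarrow> 'a rel \<Rightarrow> 'a set set" where
  "order_filters P r = {F. F \<subseteq> P \<and> (\<forall>x\<in>F. \<forall>y\<in>P. (x, y) \<in> r \<longrightarrow> y \<in> F)}"

definition minimal_elements :: "'a set \<Rightarrow> 'a rel \<Rightarrow> 'a set" where
  "minimal_elements F r = {x \<in> F. \<forall>y\<in>F. (y, x) \<in> r \<longrightarrow> y = x}"

text \<open>
  The hyperplanes above \<open>R\<close> are taken among those meeting the cone. A hyperplane
  \<open>x\<^sub>1 - x\<^sub>j = i\<close> of the arrangement missing the cone of \<open>w\<close> has \<open>x\<^sub>1 < x\<^sub>j\<close> there, hence lies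
  above every region in the cone without belonging to \<open>Psi \<iota> G w\<close>.
\<close>

definition Psi_above ::
    "(nat \<Rightarrow> 'n::finite) \<Rightarrow> nat set set \<Rightarrow> (nat \<Rightarrow> nat) \<Rightarrow> (real ^ 'n) set \<Rightarrow> (real ^ 'n) set set" where
  "Psi_above \<iota> G w R = {H \<in> Ish \<iota> G. H \<inter> cone_of_perm \<iota> w \<noteq> {} \<and> lies_above H R}"

end

theory Submission imports Defs begin

text \<open>
  Regions inside the cone are the nonempty sets cut out of the cone by a choice of side for each
  hyperplane of \<open>Psi\<close>. If \<open>x\<^sub>1 - x\<^sub>j < i\<close> on such a cell, the order of the coordinates forces
  \<open>x\<^sub>1 - x\<^sub>j\<^sub>' < i'\<close> for every larger hyperplane, so only filters occur. Conversely a filter \<open>F\<close> is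
  realised by letting the coordinate in position \<open>k\<close> be \<open>- (L k + k / (n + 1))\<close>, where \<open>L k\<close> is the
  largest \<open>i\<close> of a hyperplane outside \<open>F\<close> whose \<open>j\<close> has position at most \<open>k\<close>: the values \<open>i\<close> are
  integers, so the perturbation by less than one does not change sides.
\<close>

section \<open>Coordinate half-spaces and the sides of a hyperplane\<close>

lemma inner_axis_diff:
  fixes x :: "real ^ 'n::finite"
  shows "(axis a 1 - axis b 1) \<bullet> x = x $ a - x $ b"
  by (simp add: inner_diff_left inner_axis')

lemma axis_diff_nonzero:
  assumes "a \<noteq> b"
  shows "axis a 1 - axis b 1 \<noteq> (0 :: real ^ 'n::finite)"
proof
  assume "axis a 1 - axis b 1 = (0 :: real ^ 'n::finite)"
  then have "(axis a 1 - axis b 1 :: real ^ 'n) $ a = 0" by simp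
  then show False using assms by (simp add: axis_def)
qed

lemma convex_coord_diff_less: "convex {x :: real ^ 'n::finite. x $ a - x $ b < c}"
  using convex_halfspace_lt[of "axis a 1 - axis b 1 :: real ^ 'n" c] by (simp add: inner_axis_diff)

lemma open_coord_diff_less: "open {x :: real ^ 'n::finite. x $ a - x $ b < c}"
  using open_halfspace_lt[of "axis a 1 - axis b 1 :: real ^ 'n" c] by (simp add: inner_axis_diff)

lemma closed_coord_diff_le: "closed {x :: real ^ 'n::finite. x $ a - x $ b \<le> c}"
  using closed_halfspace_le[of "axis a 1 - axis b 1 :: real ^ 'n" c] by (simp add: inner_axis_diff)

lemma closure_coord_diff_le:
  fixes R :: "(real ^ 'n::finite) set"
  assumes "\<And>y. y \<in> R \<Longrightarrow> y $ a - y $ b < c" and "x \<in> closure R"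
  shows "x $ a - x $ b \<le> c"
proof -
  have "closure R \<subseteq> {x. x $ a - x $ b \<le> c}"
    by (rule closure_minimal) (use assms(1) closed_coord_diff_le in \<open>auto simp: less_imp_le\<close>)
  then show ?thesis using assms(2) by blast
qed

lemma hyp_eq_inner: "hyp \<iota> a b c = {x. (axis (\<iota> a) 1 - axis (\<iota> b) 1) \<bullet> x = c}"
  by (simp add: hyp_def inner_axis_diff)

text \<open>Intermediate values: one point decides the side of a whole connected set. This extends
  inequalities known at a single point of a region to the region.\<close>

lemma connected_avoiding_hyp_less:
  fixes \<iota> :: "nat \<Rightarrow> 'n::finite"
  assumes "connected R" and "R \<inter> hyp \<iota> a b c = {}"
    and "x \<in> R" and "x $ \<iota> a - x $ \<iota> b < c" and "y \<in> R"
  shows "y $ \<iota> a - y $ \<iota> b < c"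
proof (rule ccontr)
  assume "\<not> ?thesis"
  then obtain z where "z \<in> R" "(axis (\<iota> a) 1 - axis (\<iota> b) 1) \<bullet> z = c"
    using connected_ivt_hyperplane[OF assms(1,3,5), of "axis (\<iota> a) 1 - axis (\<iota> b) 1" c] assms(4)
    by (auto simp: inner_axis_diff)
  then show False using assms(2) by (auto simp: hyp_eq_inner)
qed

lemma connected_avoiding_hyp_greater:
  fixes \<iota> :: "nat \<Rightarrow> 'n::finite"
  assumes "connected R" and "R \<inter> hyp \<iota> a b c = {}"
    and "x \<in> R" and "x $ \<iota> a - x $ \<iota> b > c" and "y \<in> R"
  shows "y $ \<iota> a - y $ \<iota> b > c"
proof -
  have "hyp \<iota> b a (-c) = hyp \<iota> a b c" by (auto simp: hyp_def)
  then show ?thesis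
    using connected_avoiding_hyp_less[of R \<iota> b a "-c" x y] assms by auto
qed

text \<open>A ray from the origin meets \<open>H\<close> at most once, at the same point for every equation of \<open>H\<close>.\<close>

lemma halfspace_mono_of_hyperplane_eq:
  fixes a :: "'a::euclidean_space"
  assumes "b' > 0" "b > 0" "{x. a \<bullet> x = b} = {x. a' \<bullet> x = b'}" "a \<bullet> y < b"
  shows "a' \<bullet> y < b'"
proof (rule ccontr)
  assume n: "\<not> a' \<bullet> y < b'"
  \<comment> \<open>\<open>s\<close> scales \<open>y\<close> back onto the hyperplane;
    \<open>a' \<bullet> y \<ge> b' > 0\<close> puts it in (0, 1].\<close>
  define s where "s = b' / (a' \<bullet> y)"
  have s: "0 < s" "s \<le> 1" using n assms(1) by (auto simp: s_def field_simps)
  have "a' \<bullet> (s *\<^sub>R y) = b'" using n assms(1) by (auto simp: s_def)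
  then have "a \<bullet> (s *\<^sub>R y) = b" using assms(3) by blast
  then have "s * (a \<bullet> y) = b" by simp
  moreover have "s * (a \<bullet> y) < b"
  proof (cases "a \<bullet> y \<ge> 0")
    case True
    then have "s * (a \<bullet> y) \<le> 1 * (a \<bullet> y)" using s by (intro mult_right_mono) auto
    then show ?thesis using assms(4) by simp
  next
    case False
    then have "s * (a \<bullet> y) < 0" using s by (simp add: mult_pos_neg)
    then show ?thesis using assms(2) by simp
  qed
  ultimately show False by simp
qed

text \<open>\<open>lies_above\<close> ranges over all equations of the hyperplane. Having the origin
  in the half-space makes the constant positive, and all equations with positive constant cut out
  the same side.\<close>

lemma lies_above_hyperplane_iff:
  fixes a :: "'a::euclidean_space"
  assumes "a \<noteq> 0" "b > 0"
  shows "lies_above {x. a \<bullet> x = b} R \<longleftrightarrow> (\<forall>x\<in>R. a \<bullet> x < b)"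
proof
  assume "lies_above {x. a \<bullet> x = b} R"
  then obtain a' b' where *: "{x. a \<bullet> x = b} = {x. a' \<bullet> x = b'}"
      "R \<subseteq> {x. a' \<bullet> x < b'}" "b' > 0"
    by (auto simp: lies_above_def open_halfspaces_def)
  then show "\<forall>x\<in>R. a \<bullet> x < b"
    using halfspace_mono_of_hyperplane_eq[of b b' a' a] assms(2) by blast
next
  assume R: "\<forall>x\<in>R. a \<bullet> x < b"
  have "{x. a \<bullet> x < b} \<in> open_halfspaces {x. a \<bullet> x = b}"
    using assms(1) by (auto simp: open_halfspaces_def)
  then show "lies_above {x. a \<bullet> x = b} R"
    unfolding lies_above_def using R assms(2) by (intro conjI bexI) auto
qed

section \<open>Positions and labels of hyperplanes\<close>

locale ish_cone =
  fixes \<iota> :: "nat \<Rightarrow> 'n::finite"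
    and G :: "nat set set"
    and w :: "nat \<Rightarrow> nat"
  assumes bij: "bij_betw \<iota> {1..CARD('n)} UNIV"
    and graph: "G \<subseteq> {e. e \<subseteq> {1..CARD('n)} \<and> card e = 2}"
    and perm: "w permutes {1..CARD('n)}"
begin

declare One_nat_def [simp del]

abbreviation pos :: "nat \<Rightarrow> nat" where "pos \<equiv> inv w"

abbreviation H :: "nat \<Rightarrow> nat \<Rightarrow> (real ^ 'n) set" where "H i j \<equiv> hyp \<iota> 1 j (real i)"

abbreviation C :: "(real ^ 'n) set" where "C \<equiv> cone_of_perm \<iota> w"

definition pos_edges :: "(nat \<times> nat) set" where
  "pos_edges = {(i, j). edge G i j \<and> pos 1 < pos j}"

text \<open>\<open>K\<close> lists the constraints imposed. All of \<open>pos_edges\<close> yields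
  the regions; leaving out one pair yields a cell that can straddle the forgotten hyperplane, as the
  study of ceilings requires.\<close>

definition cell :: "(nat \<times> nat) set \<Rightarrow> (real ^ 'n) set set \<Rightarrow> (real ^ 'n) set" where
  "cell K F = {x \<in> C. \<forall>(i, j)\<in>K.
     if H i j \<in> F then x $ \<iota> 1 - x $ \<iota> j < real i else real i < x $ \<iota> 1 - x $ \<iota> j}"

lemma \<iota>_eq_iff: "a \<in> {1..CARD('n)} \<Longrightarrow> b \<in> {1..CARD('n)} \<Longrightarrow> \<iota> a = \<iota> b \<longleftrightarrow> a = b"
  by (rule inj_on_eq_iff[OF bij_betw_imp_inj_on[OF bij]])

lemma edgeD:
  assumes "edge G i j"
  shows "1 \<le> i" "i < j" "j \<le> CARD('n)" "j \<in> {1..CARD('n)}" "1 \<in> {1..CARD('n)}" "\<iota> 1 \<noteq> \<iota> j"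
proof -
  show *: "1 \<le> i" "i < j" "j \<le> CARD('n)" using assms graph by (auto simp: edge_def)
  then show **: "j \<in> {1..CARD('n)}" "1 \<in> {1..CARD('n)}" by auto
  show "\<iota> 1 \<noteq> \<iota> j" using \<iota>_eq_iff[OF **(2,1)] * by auto
qed

lemma pos_in: "a \<in> {1..CARD('n)} \<Longrightarrow> pos a \<in> {1..CARD('n)}"
  by (simp only: permutes_in_image[OF permutes_inv[OF perm]])

lemma pos_eq_iff: "pos a = pos b \<longleftrightarrow> a = b"
  using permutes_inv_eq[OF perm] by metis

lemma w_pos: "w (pos a) = a"
  by (rule permutes_inverses(1)[OF perm])

lemma pos_w: "pos (w a) = a"
  by (rule permutes_inverses(2)[OF perm])

lemma finite_pos_edges: "finite pos_edges"
proof (rule finite_subset)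
  show "pos_edges \<subseteq> {..CARD('n)} \<times> {..CARD('n)}" using edgeD by (fastforce simp: pos_edges_def)
qed auto

lemma ex_coordinates: "\<exists>x :: real ^ 'n. \<forall>j\<in>{1..CARD('n)}. x $ \<iota> j = f j"
proof
  show "\<forall>j\<in>{1..CARD('n)}. (\<chi> a. f (inv_into {1..CARD('n)} \<iota> a)) $ \<iota> j = f j"
    using bij by (simp add: bij_betw_def)
qed

text \<open>Two test points of \<open>H i j\<close> differ only in the coordinates other than 1 and
  \<open>j\<close>, set to -1 and to -2. If \<open>j'\<close> were not \<open>j\<close>, then
  \<open>i'\<close> would equal both \<open>i + 1\<close> and \<open>i + 2\<close>. An inclusion is
  assumed rather than equality because the facet argument supplies only that.\<close>

lemma H_subset_imp_eq:
  assumes "edge G i j" "edge G i' j'" "H i j \<subseteq> H i' j'"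
  shows "i = i' \<and> j = j'"
proof -
  define f :: "nat \<Rightarrow> real" where "f a = (if a = 1 then real i else if a = j then 0 else -1)" for a
  obtain x :: "real ^ 'n" where x: "\<And>a. a \<in> {1..CARD('n)} \<Longrightarrow> x $ \<iota> a = f a"
    using ex_coordinates[of f] by blast
  have "x \<in> H i j"
    using edgeD[OF assms(1)] x[of 1] x[of j] by (auto simp: hyp_def f_def)
  then have "x \<in> H i' j'" using assms(3) by blast
  then have a: "f 1 - f j' = real i'"
    using x[of 1] x[of j'] edgeD[OF assms(2)] by (auto simp: hyp_def)
  define g :: "nat \<Rightarrow> real" where "g a = (if a = 1 then real i else if a = j then 0 else -2)" for a
  obtain y :: "real ^ 'n" where y: "\<And>a. a \<in> {1..CARD('n)} \<Longrightarrow> y $ \<iota> a = g a"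
    using ex_coordinates[of g] by blast
  have "y \<in> H i j"
    using edgeD[OF assms(1)] y[of 1] y[of j] by (auto simp: hyp_def g_def)
  then have "y \<in> H i' j'" using assms(3) by blast
  then have b: "g 1 - g j' = real i'"
    using y[of 1] y[of j'] edgeD[OF assms(2)] by (auto simp: hyp_def)
  show ?thesis using a b edgeD[OF assms(2)] by (auto simp: f_def g_def split: if_splits)
qed

lemma H_eq_iff: "edge G i j \<Longrightarrow> edge G i' j' \<Longrightarrow> H i j = H i' j' \<longleftrightarrow> i = i' \<and> j = j'"
  using H_subset_imp_eq by blast

lemma lies_above_H_iff:
  assumes "edge G i j"
  shows "lies_above (H i j) R \<longleftrightarrow> (\<forall>x\<in>R. x $ \<iota> 1 - x $ \<iota> j < real i)"
proof -
  have "real i > 0" using edgeD[OF assms] by simp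
  from lies_above_hyperplane_iff[OF axis_diff_nonzero[OF edgeD(6)[OF assms]] this]
  show ?thesis by (simp add: hyp_eq_inner inner_axis_diff)
qed

section \<open>The cone of \<open>w\<close> and its cells\<close>

text \<open>Chaining the inequalities between neighbouring positions compares any two coordinates.
  Labels and their positions are used because the order on \<open>Psi\<close> is expressed through
  them.\<close>

lemma cone_iff:
  "x \<in> C \<longleftrightarrow> (\<forall>a\<in>{1..CARD('n)}. \<forall>b\<in>{1..CARD('n)}. pos a < pos b \<longrightarrow> x $ \<iota> b < x $ \<iota> a)"
proof
  assume x: "x \<in> C"
  have "x $ \<iota> (w l) < x $ \<iota> (w k)" if "1 \<le> k" "k < l" "l \<le> CARD('n)" for k l
    using that(2,3)
  proof (induction l)
    case (Suc l)
    have s: "x $ \<iota> (w (Suc l)) < x $ \<iota> (w l)"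
      using x that(1) Suc.prems by (auto simp: cone_of_perm_def Suc_eq_plus1)
    show ?case
    proof (cases "k = l")
      case False
      then show ?thesis using Suc s by force
    qed (use s in simp)
  qed simp
  then show "\<forall>a\<in>{1..CARD('n)}. \<forall>b\<in>{1..CARD('n)}. pos a < pos b \<longrightarrow> x $ \<iota> b < x $ \<iota> a"
    by (metis atLeastAtMost_iff pos_in w_pos)
next
  assume "\<forall>a\<in>{1..CARD('n)}. \<forall>b\<in>{1..CARD('n)}. pos a < pos b \<longrightarrow> x $ \<iota> b < x $ \<iota> a"
  moreover have "w k \<in> {1..CARD('n)}" if "k \<in> {1..CARD('n)}" for k
    using that by (simp only: permutes_in_image[OF perm])
  ultimately show "x \<in> C"
    by (auto simp: cone_of_perm_def pos_w)
qed

lemma coneD: "x \<in> C \<Longrightarrow> a \<in> {1..CARD('n)} \<Longrightarrow> b \<in> {1..CARD('n)} \<Longrightarrow> pos a < pos b \<Longrightarrow> x $ \<iota> b < x $ \<iota> a"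
  using cone_iff by blast

lemma cone_eq_Inter:
  "C = (\<Inter>k\<in>{1..<CARD('n)}. {x. x $ \<iota> (w (k + 1)) - x $ \<iota> (w k) < 0})"
  by (auto simp: cone_of_perm_def)

text \<open>Both sides of a hyperplane take the common form of a coordinate difference below a
  constant, so that convexity and openness follow from one lemma each.\<close>

lemma cell_eq_Inter:
  "cell K F = C \<inter> (\<Inter>e\<in>K. if H (fst e) (snd e) \<in> F
     then {x. x $ \<iota> 1 - x $ \<iota> (snd e) < real (fst e)}
     else {x. x $ \<iota> (snd e) - x $ \<iota> 1 < - real (fst e)})"
proof (rule set_eqI)
  fix x
  show "x \<in> cell K F \<longleftrightarrow> x \<in> C \<inter> (\<Inter>e\<in>K. if H (fst e) (snd e) \<in> F
     then {x. x $ \<iota> 1 - x $ \<iota> (snd e) < real (fst e)}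
     else {x. x $ \<iota> (snd e) - x $ \<iota> 1 < - real (fst e)})"
    unfolding cell_def Int_iff INT_iff mem_Collect_eq
    by (intro conj_cong refl ball_cong) (auto simp: case_prod_beta)
qed

lemma convex_cell: "convex (cell K F)"
  unfolding cell_eq_Inter cone_eq_Inter
  by (intro convex_Int convex_INT) (simp_all only: convex_coord_diff_less simp_thms split: if_split)

lemma open_cell: "K \<subseteq> pos_edges \<Longrightarrow> open (cell K F)"
  unfolding cell_eq_Inter cone_eq_Inter
  by (intro open_Int open_INT finite_subset[OF _ finite_pos_edges] ballI)
    (simp_all only: open_coord_diff_less finite_atLeastLessThan simp_thms split: if_split)

lemma cell_subset_cone: "cell K F \<subseteq> C"
  by (auto simp: cell_def)

lemma cellI:
  assumes "x \<in> C"
    and "\<And>i j. (i, j) \<in> K \<Longrightarrow> H i j \<in> F \<Longrightarrow> x $ \<iota> 1 - x $ \<iota> j < real i"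
    and "\<And>i j. (i, j) \<in> K \<Longrightarrow> H i j \<notin> F \<Longrightarrow> real i < x $ \<iota> 1 - x $ \<iota> j"
  shows "x \<in> cell K F"
  using assms by (auto simp: cell_def)

lemma cell_less:
  "x \<in> cell K F \<Longrightarrow> (i, j) \<in> K \<Longrightarrow> H i j \<in> F \<Longrightarrow> x $ \<iota> 1 - x $ \<iota> j < real i"
  by (auto simp: cell_def)

lemma cell_greater:
  "x \<in> cell K F \<Longrightarrow> (i, j) \<in> K \<Longrightarrow> H i j \<notin> F \<Longrightarrow> real i < x $ \<iota> 1 - x $ \<iota> j"
  by (auto simp: cell_def)

section \<open>The poset of hyperplanes meeting the cone\<close>

lemma Psi_eq: "Psi \<iota> G w = (\<lambda>(i, j). H i j) ` pos_edges"
  by (auto simp: Psi_def pos_edges_def)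

lemma H_in_Psi_iff: "edge G i j \<Longrightarrow> H i j \<in> Psi \<iota> G w \<longleftrightarrow> (i, j) \<in> pos_edges"
  unfolding Psi_def pos_edges_def using H_eq_iff by blast

text \<open>The order is defined by the existence of labels; these are unique by
  \<open>H_eq_iff\<close>, so it can be read off from any given ones.\<close>

lemma Psi_order_iff:
  assumes "(i, j) \<in> pos_edges" "(i', j') \<in> pos_edges"
  shows "(H i j, H i' j') \<in> Psi_order \<iota> G w \<longleftrightarrow> i \<le> i' \<and> pos j' \<le> pos j"
proof
  assume "(H i j, H i' j') \<in> Psi_order \<iota> G w"
  then obtain k l k' l' where e: "edge G k l" "edge G k' l'" "H i j = H k l" "H i' j' = H k' l'"
      and o: "k \<le> k'" "pos l' \<le> pos l"
    unfolding Psi_order_def by blast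
  have "edge G i j" "edge G i' j'" using assms by (simp_all add: pos_edges_def)
  then have "i = k" "j = l" "i' = k'" "j' = l'" using e H_eq_iff by blast+
  then show "i \<le> i' \<and> pos j' \<le> pos j" using o by blast
next
  assume "i \<le> i' \<and> pos j' \<le> pos j"
  then show "(H i j, H i' j') \<in> Psi_order \<iota> G w"
    using assms unfolding Psi_order_def pos_edges_def by blast
qed

lemma H_meets_cone_iff:
  assumes "edge G i j"
  shows "H i j \<inter> C \<noteq> {} \<longleftrightarrow> (i, j) \<in> pos_edges"
proof
  assume "H i j \<inter> C \<noteq> {}"
  then obtain x where x: "x $ \<iota> 1 - x $ \<iota> j = real i" "x \<in> C" by (auto simp: hyp_def)
  then have "\<not> pos j < pos 1"
    using coneD[OF x(2), of j 1] edgeD[OF assms] by force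
  moreover have "pos j \<noteq> pos 1" using pos_eq_iff edgeD[OF assms] by auto
  ultimately show "(i, j) \<in> pos_edges" using assms by (auto simp: pos_edges_def)
next
  assume e: "(i, j) \<in> pos_edges"
  \<comment> \<open>The witness has equally spaced coordinates decreasing along \<open>w\<close>;
    the spacing \<open>c\<close> is chosen so that the coordinates of 1 and \<open>j\<close> differ
    by exactly \<open>i\<close>.\<close>
  define c where "c = real i / (real (pos j) - real (pos 1))"
  have l: "real (pos j) - real (pos 1) > 0" using e by (auto simp: pos_edges_def)
  then have c: "c > 0" using edgeD[OF assms] by (auto simp: c_def)
  obtain x :: "real ^ 'n" where x: "\<And>a. a \<in> {1..CARD('n)} \<Longrightarrow> x $ \<iota> a = - c * real (pos a)"
    using ex_coordinates[of "\<lambda>a. - c * real (pos a)"] by blast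
  have "x \<in> C" using c by (auto simp: cone_iff x)
  moreover have "x $ \<iota> 1 - x $ \<iota> j = c * (real (pos j) - real (pos 1))"
    using edgeD[OF assms] x[of 1] x[of j] by (simp add: algebra_simps)
  then have "x \<in> H i j" using l by (auto simp: hyp_def c_def)
  ultimately show "H i j \<inter> C \<noteq> {}" by blast
qed

lemma Psi_eq_meeting:
  "Psi \<iota> G w = {A \<in> Ish \<iota> G. 0 \<notin> A \<and> A \<inter> C \<noteq> {}}"
proof -
  have "0 \<notin> H i j" if "edge G i j" for i j
    using edgeD[OF that] by (auto simp: hyp_def)
  moreover have "0 \<in> hyp \<iota> i j 0" for i j
    by (auto simp: hyp_def)
  moreover have "H i j \<inter> C \<noteq> {} \<longleftrightarrow> pos 1 < pos j" if "edge G i j" for i j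
    using H_meets_cone_iff[OF that] that by (simp add: pos_edges_def)
  ultimately show ?thesis
    unfolding Psi_def Ish_def by blast
qed

lemma partial_order_Psi: "partial_order_on (Psi \<iota> G w) (Psi_order \<iota> G w)"
  unfolding partial_order_on_def preorder_on_def
proof (intro conjI)
  show "Psi_order \<iota> G w \<subseteq> Psi \<iota> G w \<times> Psi \<iota> G w"
    by (auto simp: Psi_order_def Psi_def)
  then have sub: "\<And>A B. (A, B) \<in> Psi_order \<iota> G w \<Longrightarrow> A \<in> Psi \<iota> G w \<and> B \<in> Psi \<iota> G w" by blast
  show "refl_on (Psi \<iota> G w) (Psi_order \<iota> G w)"
    using Psi_order_iff by (auto simp: refl_on_def Psi_eq)
  show "trans (Psi_order \<iota> G w)"
  proof (rule transI)
    fix A B D assume o: "(A, B) \<in> Psi_order \<iota> G w" "(B, D) \<in> Psi_order \<iota> G w"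
    obtain i j k l m n where e: "A = H i j" "B = H k l" "D = H m n"
        "(i, j) \<in> pos_edges" "(k, l) \<in> pos_edges" "(m, n) \<in> pos_edges"
      using sub[OF o(1)] sub[OF o(2)] unfolding Psi_eq by auto
    show "(A, D) \<in> Psi_order \<iota> G w"
      using o e(4-6) unfolding e(1-3) by (simp add: Psi_order_iff)
  qed
  show "antisym (Psi_order \<iota> G w)"
  proof (rule antisymI)
    fix A B assume o: "(A, B) \<in> Psi_order \<iota> G w" "(B, A) \<in> Psi_order \<iota> G w"
    obtain i j k l where e: "A = H i j" "B = H k l" "(i, j) \<in> pos_edges" "(k, l) \<in> pos_edges"
      using sub[OF o(1)] unfolding Psi_eq by auto
    have "i = k" "pos j = pos l"
      using o e(3,4) unfolding e(1,2) by (simp_all add: Psi_order_iff)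
    then show "A = B" using pos_eq_iff e by simp
  qed
qed

section \<open>Regions in the cone are cells\<close>

text \<open>The hyperplanes through the origin miss the cone, those labelled by
  \<open>pos_edges\<close> are excluded by the strict inequalities of the cell, and the remaining
  ones miss the cone by \<open>H_meets_cone_iff\<close>.\<close>

lemma cell_avoids_Ish: "cell pos_edges F \<subseteq> - \<Union>(Ish \<iota> G)"
proof -
  have "x \<notin> hyp \<iota> a b 0" if "x \<in> C" "1 \<le> a" "a < b" "b \<le> CARD('n)" for x a b
  proof -
    have "pos a \<noteq> pos b" using pos_eq_iff that by auto
    then show ?thesis
      using coneD[OF that(1), of a b] coneD[OF that(1), of b a] that(2-4)
      by (cases "pos a < pos b") (auto simp: hyp_def)
  qed
  moreover have "x \<notin> H i j" if "edge G i j" "x \<in> cell pos_edges F" for x i j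
  proof (cases "(i, j) \<in> pos_edges")
    case True
    then show ?thesis
      using cell_less[OF that(2) True] cell_greater[OF that(2) True] by (fastforce simp: hyp_def)
  next
    case False
    then show ?thesis
      using H_meets_cone_iff[OF that(1)] that(2) cell_subset_cone by blast
  qed
  ultimately show ?thesis using cell_subset_cone by (force simp: Ish_def)
qed

text \<open>One common point suffices: the cell is connected and avoids the arrangement, so it lies
  in the component \<open>R\<close>; conversely \<open>R\<close> crosses no hyperplane, so all its
  points satisfy the strict inequalities that hold at \<open>x\<close>.\<close>

lemma region_eq_cell:
  assumes "R \<in> regions (Ish \<iota> G)" "x \<in> R" "x \<in> cell pos_edges F"
  shows "R = cell pos_edges F"
proof
  have con: "connected R" and sub: "R \<subseteq> - \<Union>(Ish \<iota> G)"
    using assms(1) in_components_connected in_components_subset unfolding regions_def by blast+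
  show "cell pos_edges F \<subseteq> R"
  proof (rule components_maximal)
    show "R \<in> components (- \<Union>(Ish \<iota> G))" using assms(1) by (simp add: regions_def)
    show "connected (cell pos_edges F)" by (simp add: convex_cell convex_connected)
  qed (use assms cell_avoids_Ish in auto)
  show "R \<subseteq> cell pos_edges F"
  proof
    fix y assume y: "y \<in> R"
    have "y $ \<iota> b < y $ \<iota> a" if ab: "a \<in> {1..CARD('n)}" "b \<in> {1..CARD('n)}" "pos a < pos b" for a b
    proof -
      have x: "x $ \<iota> b < x $ \<iota> a" using coneD ab assms(3) cell_subset_cone by blast
      \<comment> \<open>\<open>Ish\<close> lists these hyperplanes with the smaller label first,
        whereas the positions may order \<open>a\<close> and \<open>b\<close> either way.\<close>
      have s: "hyp \<iota> a b 0 = hyp \<iota> b a 0" by (auto simp: hyp_def)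
      have Ish: "hyp \<iota> k l 0 \<in> Ish \<iota> G" if "1 \<le> k" "k < l" "l \<le> CARD('n)" for k l
        using that unfolding Ish_def by blast
      have "a < b \<or> b < a" using ab(3) by (metis less_irrefl linorder_neqE_nat)
      then have "hyp \<iota> a b 0 \<in> Ish \<iota> G"
        using Ish[of a b] Ish[of b a] ab s by auto
      then have "R \<inter> hyp \<iota> a b 0 = {}" using sub by blast
      from connected_avoiding_hyp_greater[OF con this assms(2) _ y] x show ?thesis by simp
    qed
    then have "y \<in> C" by (simp add: cone_iff)
    moreover have "if H i j \<in> F then y $ \<iota> 1 - y $ \<iota> j < real i else real i < y $ \<iota> 1 - y $ \<iota> j"
      if e: "(i, j) \<in> pos_edges" for i j
    proof -
      have "H i j \<in> Ish \<iota> G" using e by (auto simp: Ish_def pos_edges_def)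
      then have d: "R \<inter> H i j = {}" using sub by blast
      show ?thesis
        using cell_less[OF assms(3) e] cell_greater[OF assms(3) e]
          connected_avoiding_hyp_less[OF con d assms(2) _ y]
          connected_avoiding_hyp_greater[OF con d assms(2) _ y] by auto
    qed
    ultimately show "y \<in> cell pos_edges F" by (auto simp: cell_def)
  qed
qed

lemma cell_in_regions:
  assumes "cell pos_edges F \<noteq> {}"
  shows "cell pos_edges F \<in> regions (Ish \<iota> G)"
proof -
  obtain x where x: "x \<in> cell pos_edges F" using assms by blast
  then have "x \<in> \<Union>(regions (Ish \<iota> G))"
    unfolding regions_def Union_components using cell_avoids_Ish by blast
  then obtain R where "R \<in> regions (Ish \<iota> G)" "x \<in> R" by blast
  with region_eq_cell x show ?thesis by blast
qed

section \<open>Regions and order filters\<close>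

lemma Psi_above_eq: "Psi_above \<iota> G w R = {A \<in> Psi \<iota> G w. lies_above A R}"
  unfolding Psi_eq_meeting Psi_above_def lies_above_def by blast

lemma H_in_Psi_above_iff:
  assumes "(i, j) \<in> pos_edges"
  shows "H i j \<in> Psi_above \<iota> G w R \<longleftrightarrow> (\<forall>x\<in>R. x $ \<iota> 1 - x $ \<iota> j < real i)"
  using assms lies_above_H_iff H_in_Psi_iff by (auto simp: Psi_above_eq pos_edges_def)

text \<open>A point of the cell witnesses that hyperplanes outside \<open>F\<close> are not above
  it; over an empty cell every hyperplane of \<open>Psi\<close> would lie vacuously.\<close>

lemma Psi_above_cell:
  assumes "F \<subseteq> Psi \<iota> G w" "cell pos_edges F \<noteq> {}"
  shows "Psi_above \<iota> G w (cell pos_edges F) = F"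
proof -
  obtain x where x: "x \<in> cell pos_edges F" using assms by blast
  have "H i j \<in> Psi_above \<iota> G w (cell pos_edges F) \<longleftrightarrow> H i j \<in> F" if e: "(i, j) \<in> pos_edges" for i j
    using H_in_Psi_above_iff[OF e] cell_less[OF _ e] cell_greater[OF x e] x by fastforce
  then show ?thesis
    using assms(1) unfolding Psi_above_eq by (fastforce simp: Psi_eq)
qed

text \<open>\<open>F\<close> collects the sides taken at a single point \<open>x\<close> of
  \<open>R\<close>. Since \<open>x\<close> is on no hyperplane, it lies in the cell of
  \<open>F\<close>, which is then all of \<open>R\<close>, and \<open>Psi_above_cell\<close>
  recovers \<open>F\<close> from it.\<close>

lemma region_eq_cell_Psi_above:
  assumes "R \<in> regions (Ish \<iota> G)" "R \<subseteq> C"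
  shows "R = cell pos_edges (Psi_above \<iota> G w R)"
proof -
  obtain x where x: "x \<in> R"
    using assms(1) in_components_nonempty by (fastforce simp: regions_def)
  define F where "F = (\<lambda>(i, j). H i j) ` {(i, j) \<in> pos_edges. x $ \<iota> 1 - x $ \<iota> j < real i}"
  have F: "H i j \<in> F \<longleftrightarrow> x $ \<iota> 1 - x $ \<iota> j < real i" if "(i, j) \<in> pos_edges" for i j
    using that H_eq_iff by (auto simp: F_def pos_edges_def)
  have ne: "x $ \<iota> 1 - x $ \<iota> j \<noteq> real i" if "(i, j) \<in> pos_edges" for i j
  proof -
    have "H i j \<in> Ish \<iota> G" using that by (auto simp: Ish_def pos_edges_def)
    moreover have "R \<subseteq> - \<Union>(Ish \<iota> G)" using assms(1) in_components_subset by (auto simp: regions_def)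
    ultimately show ?thesis using x by (auto simp: hyp_def)
  qed
  have xc: "x \<in> cell pos_edges F"
  proof (rule cellI)
    show "real i < x $ \<iota> 1 - x $ \<iota> j" if "(i, j) \<in> pos_edges" "H i j \<notin> F" for i j
      using F[OF that(1)] ne[OF that(1)] that(2) by linarith
  qed (use x assms(2) F in auto)
  have R: "R = cell pos_edges F" using region_eq_cell[OF assms(1) x xc] .
  have "F \<subseteq> Psi \<iota> G w" by (auto simp: F_def Psi_eq)
  then have "Psi_above \<iota> G w R = F" unfolding R using Psi_above_cell xc by blast
  then show ?thesis using R by simp
qed

lemma Psi_above_filter:
  assumes "R \<subseteq> C"
  shows "Psi_above \<iota> G w R \<in> order_filters (Psi \<iota> G w) (Psi_order \<iota> G w)"
proof -
  have "H i' j' \<in> Psi_above \<iota> G w R"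
    if e: "(i, j) \<in> pos_edges" "(i', j') \<in> pos_edges" and A: "H i j \<in> Psi_above \<iota> G w R"
      and o: "i \<le> i'" "pos j' \<le> pos j" for i j i' j'
  proof -
    have "x $ \<iota> 1 - x $ \<iota> j' < real i'" if x: "x \<in> R" for x
    proof -
      \<comment> \<open>An earlier position means a larger coordinate, whence \<open>x\<^sub>1 -
        x\<^sub>j' \<le> x\<^sub>1 - x\<^sub>j < i \<le> i'\<close>.\<close>
      have "x $ \<iota> j \<le> x $ \<iota> j'"
      proof (cases "j = j'")
        case False
        then have "pos j' < pos j" using o(2) pos_eq_iff[of j' j] by auto
        then show ?thesis using coneD[of x j' j] x assms e edgeD by (force simp: pos_edges_def)
      qed simp
      moreover have "x $ \<iota> 1 - x $ \<iota> j < real i" using A x H_in_Psi_above_iff[OF e(1)] by blast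
      ultimately show ?thesis using o(1) by linarith
    qed
    then show ?thesis using H_in_Psi_above_iff[OF e(2)] by blast
  qed
  moreover have "Psi_above \<iota> G w R \<subseteq> Psi \<iota> G w" unfolding Psi_above_eq by blast
  ultimately show ?thesis
    using Psi_order_iff unfolding order_filters_def Psi_eq by fast
qed

lemma filter_cell_nonempty:
  assumes "F \<in> order_filters (Psi \<iota> G w) (Psi_order \<iota> G w)"
  shows "cell pos_edges F \<noteq> {}"
proof -
  \<comment> \<open>The added 0 gives a maximum even when no hyperplane qualifies, and it is
    harmless because every \<open>i\<close> is at least 1.\<close>
  define B where "B k = insert 0 {i. \<exists>j. (i, j) \<in> pos_edges \<and> H i j \<notin> F \<and> pos j \<le> k}" for k
  define L where "L k = Max (B k)" for k
  define f where "f k = real (L k) + real k / (real CARD('n) + 1)" for k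
  have fin: "finite (B k)" for k
  proof -
    have "B k \<subseteq> insert 0 (fst ` pos_edges)" by (force simp: B_def)
    then show ?thesis using finite_pos_edges finite_subset by blast
  qed
  have ne: "B k \<noteq> {}" for k by (simp add: B_def)
  have mono: "f k < f l" if "k < l" for k l
  proof -
    have "B k \<subseteq> B l" using that by (force simp: B_def)
    then have "L k \<le> L l" unfolding L_def by (rule Max_mono[OF _ ne fin])
    moreover have "real k / (real CARD('n) + 1) < real l / (real CARD('n) + 1)"
      using that by (simp add: divide_strict_right_mono)
    ultimately show ?thesis unfolding f_def by linarith
  qed
  \<comment> \<open>Pairs in \<open>pos_edges\<close> have \<open>j\<close> placed after 1, so none
    contributes here; thus \<open>x\<^sub>1 - x\<^sub>j\<close> is \<open>L (pos j)\<close> plus a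
    fraction strictly between 0 and 1.\<close>
  have L1: "L (pos 1) = 0"
  proof -
    have "B (pos 1) = {0}" by (auto simp: B_def pos_edges_def)
    then show ?thesis by (simp add: L_def)
  qed
  obtain x :: "real ^ 'n" where x: "\<And>a. a \<in> {1..CARD('n)} \<Longrightarrow> x $ \<iota> a = - f (pos a)"
    using ex_coordinates[of "\<lambda>a. - f (pos a)"] by blast
  have "x \<in> C" using mono by (auto simp: cone_iff x)
  moreover have "if H i j \<in> F then x $ \<iota> 1 - x $ \<iota> j < real i else real i < x $ \<iota> 1 - x $ \<iota> j"
    if e: "(i, j) \<in> pos_edges" for i j
  proof -
    have ed: "edge G i j" "pos 1 < pos j" using e by (auto simp: pos_edges_def)
    have "x $ \<iota> 1 - x $ \<iota> j
        = real (L (pos j)) + (real (pos j) - real (pos 1)) / (real CARD('n) + 1)"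
      using x[of 1] x[of j] edgeD[OF ed(1)] L1 by (simp add: f_def diff_divide_distrib)
    moreover have "0 < (real (pos j) - real (pos 1)) / (real CARD('n) + 1)"
      using ed(2) by simp
    moreover have "(real (pos j) - real (pos 1)) / (real CARD('n) + 1) < 1"
      using pos_in[of j] edgeD[OF ed(1)] by simp
    ultimately have b: "real (L (pos j)) < x $ \<iota> 1 - x $ \<iota> j" "x $ \<iota> 1 - x $ \<iota> j < real (L (pos j)) + 1"
      by linarith+
    show ?thesis
    proof (cases "H i j \<in> F")
      case True
      have "L (pos j) \<in> B (pos j)" unfolding L_def using fin ne by (rule Max_in)
      then have "L (pos j) < i"
      proof (unfold B_def, elim insertE)
        assume "L (pos j) = 0" then show ?thesis using edgeD[OF ed(1)] by simp
      next
        assume "L (pos j) \<in> {i. \<exists>j'. (i, j') \<in> pos_edges \<and> H i j' \<notin> F \<and> pos j' \<le> pos j}"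
        then obtain j' where j': "(L (pos j), j') \<in> pos_edges" "H (L (pos j)) j' \<notin> F" "pos j' \<le> pos j"
          by blast
        show ?thesis
        proof (rule ccontr)
          \<comment> \<open>If \<open>i\<close> were at most \<open>L (pos j)\<close>, up-closure
            would put into \<open>F\<close> the very hyperplane outside \<open>F\<close> that
            attains the maximum.\<close>
          assume "\<not> ?thesis"
          then have "(H i j, H (L (pos j)) j') \<in> Psi_order \<iota> G w"
            using Psi_order_iff[OF e j'(1)] j'(3) by simp
          moreover have "H (L (pos j)) j' \<in> Psi \<iota> G w" using j'(1) by (auto simp: Psi_eq)
          ultimately show False using assms True j'(2) by (auto simp: order_filters_def)
        qed
      qed
      then have "real (L (pos j)) + 1 \<le> real i" by linarith
      then show ?thesis using True b by simp
    next
      case False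
      then have "i \<in> B (pos j)" using e by (auto simp: B_def)
      then have "i \<le> L (pos j)" unfolding L_def using fin by simp
      then show ?thesis using False b by simp
    qed
  qed
  ultimately have "x \<in> cell pos_edges F" unfolding cell_def by blast
  then show ?thesis by blast
qed

lemma bij_betw_Psi_above:
  "bij_betw (Psi_above \<iota> G w) {R \<in> regions (Ish \<iota> G). R \<subseteq> C}
     (order_filters (Psi \<iota> G w) (Psi_order \<iota> G w))"
proof (rule bij_betw_byWitness[where f' = "cell pos_edges"])
  show "\<forall>R\<in>{R \<in> regions (Ish \<iota> G). R \<subseteq> C}. cell pos_edges (Psi_above \<iota> G w R) = R"
    using region_eq_cell_Psi_above by auto
  show "\<forall>F\<in>order_filters (Psi \<iota> G w) (Psi_order \<iota> G w).
      Psi_above \<iota> G w (cell pos_edges F) = F"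
    using Psi_above_cell filter_cell_nonempty by (auto simp: order_filters_def)
  show "Psi_above \<iota> G w ` {R \<in> regions (Ish \<iota> G). R \<subseteq> C}
      \<subseteq> order_filters (Psi \<iota> G w) (Psi_order \<iota> G w)"
    using Psi_above_filter by auto
  show "cell pos_edges ` order_filters (Psi \<iota> G w) (Psi_order \<iota> G w)
      \<subseteq> {R \<in> regions (Ish \<iota> G). R \<subseteq> C}"
    using cell_in_regions filter_cell_nonempty cell_subset_cone by blast
qed

section \<open>Ceilings and minimal elements\<close>

text \<open>A member \<open>D\<close> of the filter below \<open>A\<close> contains the whole facet,
  hence its affine hull \<open>A\<close>; inclusion between two such hyperplanes forces
  equality.\<close>

lemma ceiling_minimal:
  assumes "R \<in> regions (Ish \<iota> G)" "R \<subseteq> C" "A \<in> ceilings (Ish \<iota> G) R"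
  shows "A \<in> minimal_elements (Psi_above \<iota> G w R) (Psi_order \<iota> G w)"
proof -
  obtain S where A: "A \<in> Ish \<iota> G" "lies_above A R" and S: "S facet_of closure R" "affine hull S = A"
    using assms(3) by (auto simp: ceilings_def)
  have "0 \<notin> A" using A(2) by (simp add: lies_above_def)
  then obtain i j where ij: "A = H i j" "edge G i j"
    using A(1) by (auto simp: Ish_def hyp_def)
  have Scl: "S \<subseteq> closure R" using S(1) facet_of_imp_subset by blast
  have SH: "x $ \<iota> 1 - x $ \<iota> j = real i" if "x \<in> S" for x
    using that S(2) hull_subset[of S affine] ij by (auto simp: hyp_def)
  obtain s where s: "s \<in> S" using S(1) by (auto simp: facet_of_def)
  \<comment> \<open>With \<open>j\<close> placed before 1, \<open>x\<^sub>1 - x\<^sub>j\<close> is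
    at most 0 on the closure of \<open>R\<close>, yet it equals \<open>i > 0\<close> on the
    facet.\<close>
  have "pos 1 < pos j"
  proof (rule ccontr)
    assume "\<not> ?thesis"
    moreover have "pos 1 \<noteq> pos j" using pos_eq_iff edgeD[OF ij(2)] by auto
    ultimately have "y $ \<iota> 1 - y $ \<iota> j < 0" if "y \<in> R" for y
      using coneD[of y j 1] that assms(2) edgeD[OF ij(2)] by force
    then have "s $ \<iota> 1 - s $ \<iota> j \<le> 0" using closure_coord_diff_le s Scl by blast
    then show False using SH[OF s] edgeD[OF ij(2)] by simp
  qed
  then have e: "(i, j) \<in> pos_edges" using ij by (simp add: pos_edges_def)
  have "D = A" if D: "D \<in> Psi_above \<iota> G w R" "(D, A) \<in> Psi_order \<iota> G w" for D
  proof -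
    obtain k l where kl: "D = H k l" "(k, l) \<in> pos_edges"
      using D(1) by (auto simp: Psi_above_eq Psi_eq)
    then have o: "k \<le> i" "pos j \<le> pos l" using D(2) Psi_order_iff[OF kl(2) e] ij by auto
    have ed: "edge G k l" using kl by (simp add: pos_edges_def)
    \<comment> \<open>On the facet, \<open>x\<^sub>1 - x\<^sub>l\<close> is squeezed between \<open>x\<^sub>1 - x\<^sub>j = i\<close> and \<open>k \<le> i\<close>.\<close>
    have "x \<in> H k l" if x: "x \<in> S" for x
    proof -
      have "\<And>y. y \<in> R \<Longrightarrow> y $ \<iota> 1 - y $ \<iota> l < real k" using D(1) H_in_Psi_above_iff[OF kl(2)] kl(1) by blast
      then have "x $ \<iota> 1 - x $ \<iota> l \<le> real k" using closure_coord_diff_le x Scl by blast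
      moreover have "x $ \<iota> l - x $ \<iota> j \<le> 0"
      proof (cases "j = l")
        case False
        then have "pos j < pos l" using o(2) pos_eq_iff[of j l] by auto
        then have "y $ \<iota> l - y $ \<iota> j < 0" if "y \<in> R" for y
          using coneD[of y j l] that assms(2) edgeD[OF ij(2)] edgeD[OF ed] by force
        then show ?thesis using closure_coord_diff_le x Scl by blast
      qed simp
      ultimately show ?thesis using SH[OF x] o(1) by (auto simp: hyp_def)
    qed
    then have "affine hull S \<subseteq> H k l"
      by (intro hull_minimal) (auto simp: hyp_eq_inner affine_hyperplane)
    then show "D = A" using H_subset_imp_eq[OF ij(2) ed] S(2) ij kl by auto
  qed
  moreover have "A \<in> Psi_above \<iota> G w R"
    using A(2) e ij by (auto simp: Psi_above_eq Psi_eq)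
  ultimately show ?thesis by (auto simp: minimal_elements_def)
qed

text \<open>
  Removing a minimal hyperplane from the filter leaves a filter; a segment between the two
  corresponding cells crosses that hyperplane and no other, in the relative interior of the facet.
\<close>

lemma minimal_is_ceiling:
  assumes "R \<in> regions (Ish \<iota> G)" "R \<subseteq> C"
    and "A \<in> minimal_elements (Psi_above \<iota> G w R) (Psi_order \<iota> G w)"
  shows "A \<in> ceilings (Ish \<iota> G) R"
proof -
  define F where "F = Psi_above \<iota> G w R"
  have A: "A \<in> F" and Amin: "\<And>D. D \<in> F \<Longrightarrow> (D, A) \<in> Psi_order \<iota> G w \<Longrightarrow> D = A"
    using assms(3) by (auto simp: minimal_elements_def F_def)
  have filt: "F \<in> order_filters (Psi \<iota> G w) (Psi_order \<iota> G w)"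
    unfolding F_def using Psi_above_filter assms(2) by blast
  have R: "R = cell pos_edges F" unfolding F_def using region_eq_cell_Psi_above assms by blast
  obtain i j where ij: "A = H i j" "(i, j) \<in> pos_edges"
    using A by (auto simp: F_def Psi_above_eq Psi_eq)
  have ed: "edge G i j" using ij by (simp add: pos_edges_def)
  \<comment> \<open>Forgetting only the constraint of \<open>A\<close> gives a convex cell
    containing \<open>R\<close> and also a point \<open>y\<close> beyond \<open>A\<close>.\<close>
  define K where "K = pos_edges - {(i, j)}"
  have K: "pos_edges = insert (i, j) K" using ij by (auto simp: K_def)
  \<comment> \<open>Up-closure could fail only if some other member of \<open>F\<close> were below
    \<open>A\<close>, against minimality.\<close>
  have "F - {A} \<in> order_filters (Psi \<iota> G w) (Psi_order \<iota> G w)"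
    using filt Amin by (auto simp: order_filters_def)
  then obtain y where y: "y \<in> cell pos_edges (F - {A})" using filter_cell_nonempty by blast
  obtain x where x: "x \<in> R" using assms(1) in_components_nonempty by (fastforce simp: regions_def)
  have cellK: "cell K (F - {A}) = cell K F"
  proof -
    have "H k l \<noteq> A" if "(k, l) \<in> K" for k l
      using that H_eq_iff[OF _ ed] ij by (auto simp: K_def pos_edges_def)
    then have "H k l \<in> F - {A} \<longleftrightarrow> H k l \<in> F" if "(k, l) \<in> K" for k l using that by blast
    then show ?thesis by (auto intro!: cellI dest: cell_less cell_greater simp: cell_subset_cone[THEN subsetD])
  qed
  have RK: "R = cell K F \<inter> {u. u $ \<iota> 1 - u $ \<iota> j < real i}"
    using A unfolding R K ij by (auto simp: cell_def)
  have yK: "y \<in> cell K F" "real i < y $ \<iota> 1 - y $ \<iota> j"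
  proof -
    show "y \<in> cell K F" using y unfolding cellK[symmetric] K by (auto simp: cell_def)
    show "real i < y $ \<iota> 1 - y $ \<iota> j" using cell_greater[OF y ij(2)] ij(1) by blast
  qed
  have xK: "x \<in> cell K F" "x $ \<iota> 1 - x $ \<iota> j < real i" using x RK by auto
  obtain z where z: "z \<in> cell K F" "z \<in> A"
    using connected_ivt_hyperplane[OF convex_connected[OF convex_cell] xK(1) yK(1),
        of "axis (\<iota> 1) 1 - axis (\<iota> j) 1" "real i"] xK(2) yK(2)
    by (auto simp: inner_axis_diff ij hyp_def)
  \<comment> \<open>From a point \<open>u\<close> of \<open>A\<close> in the larger cell, move
    towards \<open>x\<close>: the segment stays in the convex cell and drops strictly below
    \<open>A\<close> at once, so \<open>u\<close> is a limit of points of \<open>R\<close>.\<close>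
  have inA: "A \<inter> cell K F \<subseteq> closure R"
  proof
    fix u assume u: "u \<in> A \<inter> cell K F"
    then have ui: "u $ \<iota> 1 - u $ \<iota> j = real i" by (simp add: ij hyp_def)
    have "open_segment u x \<subseteq> R"
    proof
      fix v assume v: "v \<in> open_segment u x"
      then have "v \<in> cell K F"
        using u xK(1) convex_cell convex_contains_open_segment by blast
      moreover obtain t where t: "0 < t" "v = (1 - t) *\<^sub>R u + t *\<^sub>R x"
        using v by (auto simp: in_segment)
      then have "v $ \<iota> 1 - v $ \<iota> j = (1 - t) * (u $ \<iota> 1 - u $ \<iota> j) + t * (x $ \<iota> 1 - x $ \<iota> j)"
        unfolding t(2) by (simp add: algebra_simps)
      then have "v $ \<iota> 1 - v $ \<iota> j - real i = t * (x $ \<iota> 1 - x $ \<iota> j - real i)"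
        unfolding ui by (simp add: algebra_simps)
      then have "v $ \<iota> 1 - v $ \<iota> j < real i"
        using t(1) xK(2) mult_pos_neg[of t "x $ \<iota> 1 - x $ \<iota> j - real i"] by linarith
      ultimately show "v \<in> R" using RK by blast
    qed
    then have "closure (open_segment u x) \<subseteq> closure R" by (rule closure_mono)
    moreover have "u \<noteq> x" using ui xK(2) by auto
    ultimately show "u \<in> closure R" by auto
  qed
  define S where "S = closure R \<inter> A"
  have affA: "affine A" unfolding ij hyp_eq_inner by (rule affine_hyperplane)
  have hull: "affine hull S = A"
  proof
    show "affine hull S \<subseteq> A" unfolding S_def by (rule hull_minimal) (use affA in auto)
    \<comment> \<open>The larger cell is open and meets \<open>A\<close> at \<open>z\<close>, so the
      intersection is a nonempty relatively open part of \<open>A\<close> and spans it.\<close>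
    have "affine hull (A \<inter> cell K F) = affine hull A"
      by (rule affine_hull_affine_Int_open) (use affA z open_cell K_def in auto)
    then have "affine hull (A \<inter> cell K F) = A" using affA affine_hull_eq by metis
    moreover have "A \<inter> cell K F \<subseteq> S" using inA by (auto simp: S_def)
    ultimately show "A \<subseteq> affine hull S" using hull_mono by metis
  qed
  have less: "u $ \<iota> 1 - u $ \<iota> j \<le> real i" if "u \<in> closure R" for u
    using closure_coord_diff_le[of R "\<iota> 1" "\<iota> j" "real i" u] that RK by auto
  have face: "S face_of closure R"
    unfolding S_def ij hyp_eq_inner
    by (rule face_of_Int_supporting_hyperplane_le)
      (use R convex_cell less in \<open>auto simp: inner_axis_diff intro: convex_closure\<close>)
  have "aff_dim S = aff_dim A" using hull aff_dim_affine_hull by metis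
  also have "\<dots> = int DIM(real ^ 'n) - 1"
    unfolding ij hyp_eq_inner
    using axis_diff_nonzero[of "\<iota> 1" "\<iota> j"] edgeD[OF ed] by (subst aff_dim_hyperplane) auto
  \<comment> \<open>A nonempty open \<open>R\<close> has full dimension, so the face
    \<open>S\<close>, of the dimension of a hyperplane, has codimension one.\<close>
  also have "int DIM(real ^ 'n) = aff_dim (closure R)"
  proof -
    have "open R" "R \<noteq> {}" using x open_cell R by auto
    then show ?thesis using aff_dim_open[of R] by simp
  qed
  finally have "S facet_of closure R"
    using face z inA by (auto simp: facet_of_def S_def)
  moreover have "A \<in> Ish \<iota> G" "lies_above A R"
    using A unfolding F_def Psi_above_eq Psi_eq_meeting by auto
  ultimately show ?thesis using hull by (auto simp: ceilings_def)
qed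

end

theorem theorem4p4:
  fixes \<iota> :: "nat \<Rightarrow> 'n::finite"
    and G :: "nat set set"
    and w :: "nat \<Rightarrow> nat"
  assumes "bij_betw \<iota> {1..CARD('n)} UNIV"
    and "G \<subseteq> {e. e \<subseteq> {1..CARD('n)} \<and> card e = 2}"
    and "w permutes {1..CARD('n)}"
  shows "Psi \<iota> G w = {H \<in> Ish \<iota> G. 0 \<notin> H \<and> H \<inter> cone_of_perm \<iota> w \<noteq> {}}
    \<and> partial_order_on (Psi \<iota> G w) (Psi_order \<iota> G w)
    \<and> bij_betw (Psi_above \<iota> G w)
        {R \<in> regions (Ish \<iota> G). R \<subseteq> cone_of_perm \<iota> w}
        (order_filters (Psi \<iota> G w) (Psi_order \<iota> G w))
    \<and> (\<forall>R \<in> regions (Ish \<iota> G). R \<subseteq> cone_of_perm \<iota> w \<longrightarrow>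
        minimal_elements (Psi_above \<iota> G w R) (Psi_order \<iota> G w) = ceilings (Ish \<iota> G) R)"
proof -
  interpret ish_cone \<iota> G w using assms by unfold_locales
  show ?thesis
  proof (intro conjI ballI impI)
    fix R assume "R \<in> regions (Ish \<iota> G)" "R \<subseteq> cone_of_perm \<iota> w"
    then show "minimal_elements (Psi_above \<iota> G w R) (Psi_order \<iota> G w) = ceilings (Ish \<iota> G) R"
      using ceiling_minimal minimal_is_ceiling by (intro subset_antisym subsetI)
  qed (fact Psi_eq_meeting partial_order_Psi bij_betw_Psi_above)+
qed

end
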